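(* Let $\mathcal G = (\mathcal N, \mathcal P \cup \mathcal C)$ be a gas pipeline network whose underlying graph is a tree, i.e. it is connected with $|\mathcal N|$ nodes and $|\mathcal P|+|\mathcal C| = |\mathcal N|-1$ edges, and which has a single slack node, $|\mathcal S| = 1$. Then, for any given boundary data, the solution of the steady-state heterogeneous gas flow simulation (HGFS) problem on $\mathcal G$ is unique if it exists; that is, any two solutions $\big((f_{ij}),(\gamma_{ij}),(\eta_i),(\pi_i)\big)$ of the HGFS problem with the same boundary data coincide.
   Context: **Network.** $\mathcal G = (\mathcal N, \mathcal P\cup\mathcal C)$ is a finite graph with node set $\mathcal N$. Its edges are pipes ($\mathcal P$) and compressors ($\mathcal C$), each with a fixed reference orientation $(i,j)$ from $i$ to $j$. There is at most one compressor between any two nodes. The node set is partitioned as $\mathcal N = \mathcal S\cup\mathcal I\cup\mathcal W$ into slack, injection and withdrawal nodes; a node with no net injection or withdrawal is regarded as a withdrawal node with zero withdrawal. For a node $i$, $\partial_+ i$ denotes the set of edges $(j,i)$ oriented into $i$, and $\partial_- i$ the set of edges $(i,j)$ oriented out of $i$ (pipes and compressors). **Parameters.** Each pipe $(i,j)\in\mathcal P$ has an effective resistance $\beta_{ij}>0$. Let $a_h,a_{ng}>0$ be constants (the speeds of sound in hydrogen and natural gas) and $V(\gamma) = \gamma a_h^2 + (1-\gamma)a_{ng}^2$ (up to a fixed positive scaling). $H$ is the Heaviside step function, $H(x)=1$ for $x>0$ and $H(x)=0$ for $x<0$, with $H(0)\in[0,1]$ a fixed value. **Boundary data (given).** - $q_i^s\ge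 0$ and $\eta_i^s\in[0,1]$ for each $i\in\mathcal I$: injected mass flow and its hydrogen concentration (mass fraction). - $q_i^w\ge 0$ for each $i\in\mathcal W$: withdrawn mass flow. - $\alpha_{ij}\ge 1$ for each $(i,j)\in\mathcal C$: compression ratio. - $\pi_i>0$ and $\eta_i^s\in[0,1]$ for each $i\in\mathcal S$: squared pressure and injected hydrogen concentration. **Unknowns.** The mass flow $f_{ij}\in\mathbb R$ and hydrogen concentration $\gamma_{ij}\in[0,1]$ for each edge $(i,j)\in\mathcal P\cup\mathcal C$; the hydrogen concentration after mixing $\eta_i\in[0,1]$ for each $i\in\mathcal N$; the squared pressure (potential) $\pi_i\ge 0$ for each $i\in\mathcal N\setminus\mathcal S$. A positive (negative) $f_{ij}$ means flow from $i$ to $j$ (from $j$ to $i$). For a compressor $(i,j)\in\mathcal C$ the flow is along the direction of pressure boost, $f_{ij}\ge 0$. **HGFS problem.** A solution is an assignment of the unknowns satisfying all of the following. 1. For each pipe $(i,j)\in\mathcal P$: $\pi_i-\pi_j = \beta_{ij}\,V(\gamma_{ij})\,f_{ij}|f_{ij}|$ and $\gamma_{ij} = H(f_{ij})\,\eta_i + (1-H(f_{ij}))\,\eta_j$. 2. For each compressor $(i,j)\in\mathcal C$: $\pi_j = \alpha_{ij}^2\,\pi_i$ and $\gamma_{ij}=\eta_i$. 3. Mixture balance: $\sum_{(i,j)\in\partial_- i} f_{ij} - \sum_{(j,i)\in\partial_+ i} f_{ji} = q_i^s$ for $i\in\mathcal I$, and $\sum_{(i,j)\in\partial_- i} f_{ij}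 - \sum_{(j,i)\in\partial_+ i} f_{ji} = -q_i^w$ for $i\in\mathcal W$. 4. Hydrogen balance: $\sum_{(i,j)\in\partial_- i}\gamma_{ij} f_{ij} - \sum_{(j,i)\in\partial_+ i}\gamma_{ji} f_{ji} = \eta_i^s q_i^s$ for $i\in\mathcal S\cup\mathcal I$, and $\sum_{(i,j)\in\partial_- i}\gamma_{ij} f_{ij} - \sum_{(j,i)\in\partial_+ i}\gamma_{ji} f_{ji} = -\eta_i q_i^w$ for $i\in\mathcal W$. Here, for $i\in\mathcal S$, the slack injection is not given but is defined by $q_i^s := \sum_{(i,j)\in\partial_- i} f_{ij} - \sum_{(j,i)\in\partial_+ i} f_{ji}$. Slack nodes are assumed to be associated with inflow to the network, i.e. $q_i^s\ge 0$ for $i\in\mathcal S$.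
   Formalization: Concentrations are not unique at nodes with zero flow on all incident edges (e.g. zero withdrawal at a leaf). Full coincidence is proved if no such node exists; always, all f and π coincide, η at other nodes, and γ on edges with both ends at other nodes. *)

theory Defs
  imports Complex_Main "Graph_Theory.Digraph_Component"
begin

text \<open>
  A pipeline network is a finite directed multigraph: an arc with tail \<open>i\<close> and head \<open>j\<close> is an
  edge with reference orientation \<open>(i, j)\<close>.  Edges incoming to and outgoing from a node are
  \<^const>\<open>in_arcs\<close> and \<^const>\<open>out_arcs\<close>.
\<close>

record ('n, 'e) gas_network =
  net_graph :: "('n, 'e) pre_digraph"
  pipes :: "'e set"
  compressors :: "'e set"
  slack_nodes :: "'n set"
  injection_nodes :: "'n set"
  withdrawal_nodes :: "'n set"
  resistance :: "'e \<Rightarrow> real"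

definition valid_network :: "('n, 'e) gas_network \<Rightarrow> bool" where
  "valid_network N \<longleftrightarrow>
     fin_digraph (net_graph N) \<and>
     pipes N \<union> compressors N = arcs (net_graph N) \<and>
     pipes N \<inter> compressors N = {} \<and>
     (\<forall>c\<in>compressors N. \<forall>d\<in>compressors N.
        {tail (net_graph N) c, head (net_graph N) c} = {tail (net_graph N) d, head (net_graph N) d}
        \<longrightarrow> c = d) \<and>
     slack_nodes N \<union> injection_nodes N \<union> withdrawal_nodes N = verts (net_graph N) \<and>
     slack_nodes N \<inter> injection_nodes N = {} \<and>
     slack_nodes N \<inter> withdrawal_nodes N = {} \<and>
     injection_nodes N \<inter> withdrawal_nodes N = {} \<and>
     (\<forall>e\<in>pipes N. resistance N e > 0)"

text \<open>
  \<open>heaviside_zero\<close> is the value of the Heaviside function at 0, and \<open>eos_scaling\<close> the fixed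
  positive factor up to which the equation-of-state function \<open>V\<close> is given.
\<close>

record gas_params =
  speed_hydrogen :: real
  speed_natural_gas :: real
  eos_scaling :: real
  heaviside_zero :: real

definition valid_params :: "gas_params \<Rightarrow> bool" where
  "valid_params p \<longleftrightarrow> speed_hydrogen p > 0 \<and> speed_natural_gas p > 0 \<and> eos_scaling p > 0 \<and>
     0 \<le> heaviside_zero p \<and> heaviside_zero p \<le> 1"

definition eos_V :: "gas_params \<Rightarrow> real \<Rightarrow> real" where
  "eos_V p c = eos_scaling p * (c * (speed_hydrogen p)\<^sup>2 + (1 - c) * (speed_natural_gas p)\<^sup>2)"

definition heaviside :: "gas_params \<Rightarrow> real \<Rightarrow> real" where
  "heaviside p x = (if x > 0 then 1 else if x < 0 then 0 else heaviside_zero p)"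

record ('n, 'e) boundary_data =
  injection :: "'n \<Rightarrow> real"            (* q^s, on injection nodes *)
  injected_conc :: "'n \<Rightarrow> real"        (* eta^s, on slack and injection nodes *)
  withdrawal :: "'n \<Rightarrow> real"           (* q^w, on withdrawal nodes *)
  compression_ratio :: "'e \<Rightarrow> real"    (* alpha, on compressors *)
  slack_potential :: "'n \<Rightarrow> real"      (* squared pressure, on slack nodes *)

definition valid_boundary_data :: "('n, 'e) gas_network \<Rightarrow> ('n, 'e) boundary_data \<Rightarrow> bool" where
  "valid_boundary_data N b \<longleftrightarrow>
     (\<forall>i\<in>injection_nodes N. injection b i \<ge> 0) \<and>
     (\<forall>i\<in>slack_nodes N \<union> injection_nodes N. 0 \<le> injected_conc b i \<and> injected_conc b i \<le> 1) \<and>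
     (\<forall>i\<in>withdrawal_nodes N. withdrawal b i \<ge> 0) \<and>
     (\<forall>e\<in>compressors N. compression_ratio b e \<ge> 1) \<and>
     (\<forall>i\<in>slack_nodes N. slack_potential b i > 0)"

record ('n, 'e) gas_state =
  flow :: "'e \<Rightarrow> real"        (* f *)
  edge_conc :: "'e \<Rightarrow> real"   (* gamma *)
  node_conc :: "'n \<Rightarrow> real"   (* eta *)
  potential :: "'n \<Rightarrow> real"   (* pi, prescribed on slack nodes *)

definition net_outflow :: "('n, 'e) gas_network \<Rightarrow> ('e \<Rightarrow> real) \<Rightarrow> 'n \<Rightarrow> real" where
  "net_outflow N f i =
     (\<Sum>e\<in>out_arcs (net_graph N) i. f e) - (\<Sum>e\<in>in_arcs (net_graph N) i. f e)"

definition hydrogen_outflow :: "('n, 'e) gas_network \<Rightarrow> ('n, 'e) gas_state \<Rightarrow> 'n \<Rightarrow> real" where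
  "hydrogen_outflow N x i = net_outflow N (\<lambda>e. edge_conc x e * flow x e) i"

definition hgfs_solution ::
  "('n, 'e) gas_network \<Rightarrow> gas_params \<Rightarrow> ('n, 'e) boundary_data \<Rightarrow> ('n, 'e) gas_state \<Rightarrow> bool" where
  "hgfs_solution N p b x \<longleftrightarrow>
     (\<forall>e\<in>arcs (net_graph N). 0 \<le> edge_conc x e \<and> edge_conc x e \<le> 1) \<and>
     (\<forall>i\<in>verts (net_graph N). 0 \<le> node_conc x i \<and> node_conc x i \<le> 1) \<and>
     (\<forall>i\<in>verts (net_graph N) - slack_nodes N. potential x i \<ge> 0) \<and>
     (\<forall>i\<in>slack_nodes N. potential x i = slack_potential b i) \<and>
     (\<forall>e\<in>compressors N. flow x e \<ge> 0) \<and>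
     (\<forall>i\<in>slack_nodes N. net_outflow N (flow x) i \<ge> 0) \<and>
     (\<forall>e\<in>pipes N.
        potential x (tail (net_graph N) e) - potential x (head (net_graph N) e) =
          resistance N e * eos_V p (edge_conc x e) * (flow x e * \<bar>flow x e\<bar>) \<and>
        edge_conc x e =
          heaviside p (flow x e) * node_conc x (tail (net_graph N) e) +
          (1 - heaviside p (flow x e)) * node_conc x (head (net_graph N) e)) \<and>
     (\<forall>e\<in>compressors N.
        potential x (head (net_graph N) e) =
          (compression_ratio b e)\<^sup>2 * potential x (tail (net_graph N) e) \<and>
        edge_conc x e = node_conc x (tail (net_graph N) e)) \<and>
     (\<forall>i\<in>injection_nodes N. net_outflow N (flow x) i = injection b i) \<and>
     (\<forall>i\<in>withdrawal_nodes N. net_outflow N (flow x) i = - withdrawal b i) \<and>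
     (\<forall>i\<in>injection_nodes N. hydrogen_outflow N x i = injected_conc b i * injection b i) \<and>
     (\<forall>i\<in>slack_nodes N. hydrogen_outflow N x i = injected_conc b i * net_outflow N (flow x) i) \<and>
     (\<forall>i\<in>withdrawal_nodes N. hydrogen_outflow N x i = - (node_conc x i * withdrawal b i))"

definition coincide :: "('n, 'e) gas_network \<Rightarrow> ('n, 'e) gas_state \<Rightarrow> ('n, 'e) gas_state \<Rightarrow> bool" where
  "coincide N x y \<longleftrightarrow>
     (\<forall>e\<in>arcs (net_graph N). flow x e = flow y e \<and> edge_conc x e = edge_conc y e) \<and>
     (\<forall>i\<in>verts (net_graph N). node_conc x i = node_conc y i \<and> potential x i = potential y i)"

text \<open>
  No gas passes through a stagnant node (the balance equations then also force its injection or
  withdrawal to vanish).  Such a node has no mixture: every equation involving its concentration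
  is either multiplied by a zero flow or merely defines the concentration on an incident edge
  without flow, so the concentration there can be chosen arbitrarily.
\<close>

definition stagnant :: "('n, 'e) gas_network \<Rightarrow> ('n, 'e) gas_state \<Rightarrow> 'n \<Rightarrow> bool" where
  "stagnant N x i \<longleftrightarrow>
     (\<forall>e\<in>in_arcs (net_graph N) i \<union> out_arcs (net_graph N) i. flow x e = 0)"

end

theory Submission
  imports Defs
begin

text \<open>
  Both halves of the proof rest on one fact about trees: a function on the edges whose net outflow
  vanishes at every node is zero (\<open>circulation_on_tree_eq_0\<close>).  Deleting an edge leaves too few
  edges to connect the nodes, so some cut is crossed by that edge alone, and summing the net
  outflow over one side of the cut isolates its flow.

  Two solutions have the same prescribed net outflow at all nodes but the slack node, hence also
  there, so their mass flows agree.  Let \<open>d\<close> be the difference of the node concentrations,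
  \<open>\<delta>\<close> that of the edge concentrations and \<open>f\<close> the common flow.  The hydrogen balance says that
  \<open>\<delta> f\<close> has net outflow \<open>- w d\<close>, where \<open>w \<ge> 0\<close> is the withdrawal.  Since \<open>\<delta>\<close> takes its value
  from the upstream node, \<open>\<bar>\<delta>\<bar> f\<close> has net outflow at most \<open>- w \<bar>d\<bar>\<close>: mixing cannot increase
  the absolute difference.  The net outflows add up to zero over the network, so all these
  inequalities are equalities, \<open>\<bar>\<delta>\<bar> f\<close> is a circulation, and on a tree it vanishes.  Thus a
  node with \<open>d \<noteq> 0\<close> sends nothing downstream and withdraws nothing, so nothing enters it either:
  it is stagnant (\<open>concentration_difference_only_at_stagnant\<close>).  Using \<open>\<bar>\<delta>\<bar> f\<close> avoids
  following the gas from the sources downstream.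

  With equal flows, and equal concentrations wherever the flow is nonzero, both solutions have
  the same pressure drop on each pipe and the same ratio on each compressor, so equality of the
  potentials spreads from the slack node through the connected network.
\<close>

section \<open>Cuts and circulations\<close>

lemma connected_cut_crossed:
  assumes "connected G" "u \<in> verts G" "u \<in> U" "v \<in> verts G" "v \<notin> U"
  shows "\<exists>e\<in>arcs G. (tail G e \<in> U) \<noteq> (head G e \<in> U)"
proof (rule ccontr)
  assume uncrossed: "\<not> ?thesis"
  have "(u, v) \<in> rtrancl_on (verts G) ((arcs_ends G)\<^sup>s)"
    using assms by (simp add: connected_conv)
  then have "(u, v) \<in> ((arcs_ends G)\<^sup>s)\<^sup>*"
    by (rule rtrancl_on_rtranclI)
  then have "v \<in> U"
    using \<open>u \<in> U\<close>
  proof induction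
    case (step y z)
    then show ?case
      using uncrossed by (auto simp: symcl_def arcs_ends_conv)
  qed
  with \<open>v \<notin> U\<close> show False by blast
qed

text \<open>
  The bound that a connected graph on \<open>n\<close> nodes has at least \<open>n - 1\<close> edges, stated for cuts.
  If every cut were crossed, a set of nodes could be grown one node at a time, each step using
  up a new edge.
\<close>

lemma uncrossed_cut_if_few_edges:
  fixes t h :: "'e \<Rightarrow> 'n"
  assumes fin: "finite V" "finite E" and V: "t ` E \<subseteq> V" "h ` E \<subseteq> V"
    and few: "card E + 1 < card V"
  shows "\<exists>U. U \<subseteq> V \<and> U \<noteq> {} \<and> U \<noteq> V \<and> (\<forall>e\<in>E. t e \<in> U \<longleftrightarrow> h e \<in> U)"
proof (rule ccontr)
  assume crossed: "\<not> ?thesis"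
  have grow: "\<exists>U F. U \<subseteq> V \<and> F \<subseteq> E \<and> t ` F \<subseteq> U \<and> h ` F \<subseteq> U \<and> card U = Suc k \<and> card F = k"
    if "Suc k \<le> card V" for k
    using that
  proof (induction k)
    case 0
    then obtain a where "a \<in> V" using few by fastforce
    then show ?case by (intro exI[of _ "{a}"] exI[of _ "{}"]) auto
  next
    case (Suc k)
    then obtain U F where UF: "U \<subseteq> V" "F \<subseteq> E" "t ` F \<subseteq> U" "h ` F \<subseteq> U"
      "card U = Suc k" "card F = k" by auto
    have "U \<noteq> {}" "U \<noteq> V" using UF(5) Suc.prems by auto
    then obtain e where e: "e \<in> E" "t e \<in> U \<longleftrightarrow> h e \<notin> U"
      using crossed UF(1) by blast
    obtain z where z: "z \<in> V" "z \<notin> U" "t e \<in> insert z U" "h e \<in> insert z U"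
      using e V by (cases "t e \<in> U") auto
    have "e \<notin> F" using e UF by auto
    moreover have "finite U" "finite F" using UF fin finite_subset by blast+
    ultimately have "card (insert z U) = Suc (Suc k)" "card (insert e F) = Suc k"
      using UF z by auto
    then show ?case
      using UF e z by (intro exI[of _ "insert z U"] exI[of _ "insert e F"]) auto
  qed
  have "Suc (card V - 1) \<le> card V" using few by simp
  from grow[OF this] obtain F where "F \<subseteq> E" "card F = card V - 1" by blast
  then show False using card_mono[OF fin(2), of F] few by simp
qed

lemma sum_net_outflow:
  assumes G: "fin_digraph (net_graph N)" and U: "U \<subseteq> verts (net_graph N)"
  shows "(\<Sum>i\<in>U. net_outflow N f i) =
    (\<Sum>e\<in>arcs (net_graph N).
       f e * (of_bool (tail (net_graph N) e \<in> U) - of_bool (head (net_graph N) e \<in> U)))"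
proof -
  interpret fin_digraph "net_graph N" by fact
  have finU: "finite U" using U finite_verts finite_subset by blast
  have swap: "(\<Sum>i\<in>U. \<Sum>e\<in>{e \<in> arcs (net_graph N). k e = i}. f e) =
      (\<Sum>e\<in>arcs (net_graph N). f e * of_bool (k e \<in> U))" for k
  proof -
    have "(\<Sum>i\<in>U. \<Sum>e\<in>{e \<in> arcs (net_graph N). k e = i}. f e) =
        (\<Sum>i\<in>U. \<Sum>e\<in>arcs (net_graph N). if k e = i then f e else 0)"
      by (simp add: sum.inter_filter)
    also have "\<dots> = (\<Sum>e\<in>arcs (net_graph N). \<Sum>i\<in>U. if k e = i then f e else 0)"
      by (rule sum.swap)
    also have "\<dots> = (\<Sum>e\<in>arcs (net_graph N). f e * of_bool (k e \<in> U))"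
      using finU by (intro sum.cong) auto
    finally show ?thesis .
  qed
  show ?thesis
    unfolding net_outflow_def out_arcs_def in_arcs_def
    by (simp add: sum_subtractf swap right_diff_distrib)
qed

lemma sum_net_outflow_verts:
  assumes "fin_digraph (net_graph N)"
  shows "(\<Sum>i\<in>verts (net_graph N). net_outflow N f i) = 0"
proof -
  interpret fin_digraph "net_graph N" by fact
  show ?thesis
    by (subst sum_net_outflow[OF assms]) (auto intro: sum.neutral)
qed

lemma circulation_on_tree_eq_0:
  assumes G: "fin_digraph (net_graph N)" and conn: "connected (net_graph N)"
    and few: "card (arcs (net_graph N)) + 1 \<le> card (verts (net_graph N))"
    and circ: "\<And>i. i \<in> verts (net_graph N) \<Longrightarrow> net_outflow N g i = 0"
    and a: "a \<in> arcs (net_graph N)"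
  shows "g a = 0"
proof -
  interpret fin_digraph "net_graph N" by fact
  let ?t = "tail (net_graph N)" and ?h = "head (net_graph N)"
  let ?E = "arcs (net_graph N)" and ?V = "verts (net_graph N)"
  have "card (?E - {a}) + 1 < card ?V"
    using few a card_Suc_Diff1[OF finite_arcs a] by linarith
  then obtain U where U: "U \<subseteq> ?V" "U \<noteq> {}" "U \<noteq> ?V"
    and uncrossed: "\<forall>e\<in>?E - {a}. ?t e \<in> U \<longleftrightarrow> ?h e \<in> U"
    using uncrossed_cut_if_few_edges[of ?V "?E - {a}" ?t ?h] by (auto simp: image_subset_iff)
  obtain u v where "u \<in> U" "v \<in> ?V" "v \<notin> U" using U by blast
  then have crosses: "(?t a \<in> U) \<noteq> (?h a \<in> U)"
    using connected_cut_crossed[OF conn, of u U v] U(1) uncrossed by blast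
  have "0 = (\<Sum>i\<in>U. net_outflow N g i)"
    using circ U(1) by (simp add: subset_eq)
  also have "\<dots> = (\<Sum>e\<in>?E. g e * (of_bool (?t e \<in> U) - of_bool (?h e \<in> U)))"
    by (rule sum_net_outflow[OF G U(1)])
  also have "\<dots> = g a * (of_bool (?t a \<in> U) - of_bool (?h a \<in> U))"
    using a uncrossed by (subst sum.remove[OF finite_arcs a]) (simp add: sum.neutral)
  finally show ?thesis using crosses by (auto split: if_splits)
qed

section \<open>Transport of concentration differences\<close>

text \<open>
  On an edge that carries gas out of \<open>i\<close> the absolute value contributes exactly
  \<open>sgn (d i)\<close> times the signed quantity, because \<open>\<delta> e = d i\<close> there; on an edge that carries gas
  into \<open>i\<close> it can only be larger, and enters with a negative sign.
\<close>

lemma net_outflow_abs_le: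
  assumes upwind_tail: "\<And>e. e \<in> arcs (net_graph N) \<Longrightarrow> f e > 0 \<Longrightarrow> \<delta> e = d (tail (net_graph N) e)"
    and upwind_head: "\<And>e. e \<in> arcs (net_graph N) \<Longrightarrow> f e < 0 \<Longrightarrow> \<delta> e = d (head (net_graph N) e)"
  shows "net_outflow N (\<lambda>e. \<bar>\<delta> e\<bar> * f e) i \<le> sgn (d i) * net_outflow N (\<lambda>e. \<delta> e * f e) i"
proof -
  have sgn_le: "sgn (d i) * c \<le> \<bar>c\<bar>" for c :: real
    by (auto simp: sgn_real_def)
  have out: "\<bar>\<delta> e\<bar> * f e \<le> sgn (d i) * (\<delta> e * f e)" if "e \<in> out_arcs (net_graph N) i" for e
  proof (cases "f e > 0")
    case True
    with that have "\<delta> e = d i" using upwind_tail by (auto simp: out_arcs_def)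
    then show ?thesis by (simp add: abs_sgn mult.commute mult.left_commute)
  next
    case False
    then show ?thesis
      using mult_right_mono_neg[OF sgn_le[of "\<delta> e"], of "f e"] by (simp add: mult.assoc)
  qed
  have "in": "sgn (d i) * (\<delta> e * f e) \<le> \<bar>\<delta> e\<bar> * f e" if "e \<in> in_arcs (net_graph N) i" for e
  proof (cases "f e < 0")
    case True
    with that have "\<delta> e = d i" using upwind_head by (auto simp: in_arcs_def)
    then show ?thesis by (simp add: abs_sgn mult.commute mult.left_commute)
  next
    case False
    then show ?thesis
      using mult_right_mono[OF sgn_le[of "\<delta> e"], of "f e"] by (simp add: mult.assoc)
  qed
  show ?thesis
    unfolding net_outflow_def right_diff_distrib sum_distrib_left
    by (intro diff_mono sum_mono out "in")
qed

text \<open>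
  Here \<open>w\<close> is the withdrawal, extended by zero to the nodes without one, so that the hypothesis on
  the net outflow of \<open>f\<close> says that nodes other than withdrawals do not drain the network.
\<close>

lemma concentration_difference_only_at_stagnant:
  assumes G: "fin_digraph (net_graph N)" and conn: "connected (net_graph N)"
    and few: "card (arcs (net_graph N)) + 1 \<le> card (verts (net_graph N))"
    and upwind_tail: "\<And>e. e \<in> arcs (net_graph N) \<Longrightarrow> f e > 0 \<Longrightarrow> \<delta> e = d (tail (net_graph N) e)"
    and upwind_head: "\<And>e. e \<in> arcs (net_graph N) \<Longrightarrow> f e < 0 \<Longrightarrow> \<delta> e = d (head (net_graph N) e)"
    and w: "\<And>i. i \<in> verts (net_graph N) \<Longrightarrow> w i \<ge> 0"
    and mass: "\<And>i. i \<in> verts (net_graph N) \<Longrightarrow> net_outflow N f i \<ge> - w i"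
    and hydrogen: "\<And>i. i \<in> verts (net_graph N) \<Longrightarrow> net_outflow N (\<lambda>e. \<delta> e * f e) i = - (w i * d i)"
    and i: "i \<in> verts (net_graph N)" "d i \<noteq> 0"
    and e: "e \<in> in_arcs (net_graph N) i \<union> out_arcs (net_graph N) i"
  shows "f e = 0"
proof -
  interpret fin_digraph "net_graph N" by fact
  let ?V = "verts (net_graph N)" and ?g = "\<lambda>e. \<bar>\<delta> e\<bar> * f e"
  have le: "net_outflow N ?g j \<le> - (w j * \<bar>d j\<bar>)" if "j \<in> ?V" for j
    using net_outflow_abs_le[where N = N and f = f and \<delta> = \<delta> and d = d and i = j]
      upwind_tail upwind_head hydrogen[OF that]
    by (simp add: abs_sgn mult_ac)
  have le_0: "net_outflow N ?g j \<le> 0" if "j \<in> ?V" for j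
    using le[OF that] mult_nonneg_nonneg[OF w[OF that] abs_ge_zero[of "d j"]] by linarith
  have circ: "net_outflow N ?g j = 0" if "j \<in> ?V" for j
  proof -
    have "\<forall>j\<in>?V. - net_outflow N ?g j = 0"
      using sum_net_outflow_verts[OF G, of ?g] le_0
      by (subst sum_nonneg_eq_0_iff[symmetric]) (auto simp: sum_negf)
    then show ?thesis using that by simp
  qed
  have no_transport: "?g a = 0" if "a \<in> arcs (net_graph N)" for a
    by (rule circulation_on_tree_eq_0[OF G conn few circ that])
  have out: "f a \<le> 0" if "a \<in> out_arcs (net_graph N) i" for a
    using no_transport[of a] upwind_tail[of a] that i(2) by (force simp: out_arcs_def)
  have "in": "f a \<ge> 0" if "a \<in> in_arcs (net_graph N) i" for a
    using no_transport[of a] upwind_head[of a] that i(2) by (force simp: in_arcs_def)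
  have "w i * \<bar>d i\<bar> \<le> 0" using le[OF i(1)] circ[OF i(1)] by linarith
  then have "w i = 0" using w[OF i(1)] i(2) by (simp add: mult_le_0_iff)
  then have "(\<Sum>a\<in>in_arcs (net_graph N) i. f a) \<le> (\<Sum>a\<in>out_arcs (net_graph N) i. f a)"
    using mass[OF i(1)] by (simp add: net_outflow_def)
  moreover have "(\<Sum>a\<in>out_arcs (net_graph N) i. f a) \<le> 0" "0 \<le> (\<Sum>a\<in>in_arcs (net_graph N) i. f a)"
    using out "in" by (auto intro: sum_nonpos sum_nonneg)
  ultimately have "(\<Sum>a\<in>out_arcs (net_graph N) i. - f a) = 0" "(\<Sum>a\<in>in_arcs (net_graph N) i. f a) = 0"
    by (auto simp: sum_negf)
  then have "\<forall>a\<in>out_arcs (net_graph N) i. - f a = 0" "\<forall>a\<in>in_arcs (net_graph N) i. f a = 0"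
    using sum_nonneg_eq_0_iff[OF finite_out_arcs, of i "\<lambda>a. - f a"]
      sum_nonneg_eq_0_iff[OF finite_in_arcs, of i f] out "in" by force+
  then show ?thesis using e by auto
qed

section \<open>Uniqueness of the steady state\<close>

lemma net_outflow_diff:
  "net_outflow N (\<lambda>e. f e - g e) i = net_outflow N f i - net_outflow N g i"
  by (simp add: net_outflow_def sum_subtractf)

lemma net_outflow_cong:
  assumes "\<And>e. e \<in> arcs (net_graph N) \<Longrightarrow> f e = g e"
  shows "net_outflow N f i = net_outflow N g i"
  unfolding net_outflow_def using assms
  by (intro arg_cong2[where f = minus] sum.cong) (auto simp: in_arcs_def out_arcs_def)

lemma edge_conc_upwind:
  assumes "valid_network N" "hgfs_solution N p b x" "e \<in> arcs (net_graph N)"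
  shows "flow x e > 0 \<Longrightarrow> edge_conc x e = node_conc x (tail (net_graph N) e)"
    and "flow x e < 0 \<Longrightarrow> edge_conc x e = node_conc x (head (net_graph N) e)"
proof -
  have e: "e \<in> pipes N \<or> e \<in> compressors N" using assms by (auto simp: valid_network_def)
  show "flow x e > 0 \<Longrightarrow> edge_conc x e = node_conc x (tail (net_graph N) e)"
    using assms(2) e unfolding hgfs_solution_def heaviside_def by auto
  show "flow x e < 0 \<Longrightarrow> edge_conc x e = node_conc x (head (net_graph N) e)"
    using assms(2) e unfolding hgfs_solution_def heaviside_def by fastforce
qed

lemma hgfs_flow_unique:
  assumes N: "valid_network N" and conn: "connected (net_graph N)"
    and few: "card (arcs (net_graph N)) + 1 \<le> card (verts (net_graph N))"
    and slack: "slack_nodes N = {s}"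
    and x: "hgfs_solution N p b x" and y: "hgfs_solution N p b y"
    and e: "e \<in> arcs (net_graph N)"
  shows "flow x e = flow y e"
proof -
  have G: "fin_digraph (net_graph N)" using N by (simp add: valid_network_def)
  interpret fin_digraph "net_graph N" by fact
  let ?g = "\<lambda>e. flow x e - flow y e" and ?V = "verts (net_graph N)"
  have s: "s \<in> ?V" using N slack by (auto simp: valid_network_def)
  have non_slack: "net_outflow N ?g i = 0" if "i \<in> ?V - {s}" for i
  proof -
    have "i \<in> injection_nodes N \<or> i \<in> withdrawal_nodes N"
      using that N slack by (auto simp: valid_network_def)
    then show ?thesis using x y by (auto simp: net_outflow_diff hgfs_solution_def)
  qed
  \<comment> \<open>Nothing is prescribed at the slack node; there the balance follows from the total.\<close>
  have "net_outflow N ?g s = 0"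
    using sum_net_outflow_verts[OF G, of ?g] sum.remove[OF finite_verts s, of "net_outflow N ?g"]
      non_slack by simp
  then have "net_outflow N ?g i = 0" if "i \<in> ?V" for i
    using non_slack that by (cases "i = s") auto
  from circulation_on_tree_eq_0[OF G conn few this e] show ?thesis by simp
qed

lemma hgfs_node_conc_unique:
  assumes N: "valid_network N" and conn: "connected (net_graph N)"
    and few: "card (arcs (net_graph N)) + 1 \<le> card (verts (net_graph N))"
    and b: "valid_boundary_data N b"
    and x: "hgfs_solution N p b x" and y: "hgfs_solution N p b y"
    and flow: "\<And>e. e \<in> arcs (net_graph N) \<Longrightarrow> flow x e = flow y e"
    and i: "i \<in> verts (net_graph N)" "\<not> stagnant N x i"
  shows "node_conc x i = node_conc y i"
proof (rule ccontr)
  assume neq: "node_conc x i \<noteq> node_conc y i"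
  have G: "fin_digraph (net_graph N)" using N by (simp add: valid_network_def)
  let ?d = "\<lambda>i. node_conc x i - node_conc y i" and ?\<delta> = "\<lambda>e. edge_conc x e - edge_conc y e"
  let ?w = "\<lambda>i. if i \<in> withdrawal_nodes N then withdrawal b i else 0"
  have node_cases: "j \<in> withdrawal_nodes N \<and> j \<notin> slack_nodes N \<union> injection_nodes N \<or>
      j \<in> slack_nodes N - withdrawal_nodes N \<or> j \<in> injection_nodes N - withdrawal_nodes N"
    if "j \<in> verts (net_graph N)" for j
    using that N by (auto simp: valid_network_def)
  have mass: "net_outflow N (flow x) j \<ge> - ?w j" if "j \<in> verts (net_graph N)" for j
    using node_cases[OF that] x b by (auto simp: hgfs_solution_def valid_boundary_data_def)
  have flow_sums: "net_outflow N (flow x) j = net_outflow N (flow y) j" for j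
    by (rule net_outflow_cong) (rule flow)
  have hydrogen: "net_outflow N (\<lambda>e. ?\<delta> e * flow x e) j = - (?w j * ?d j)"
    if "j \<in> verts (net_graph N)" for j
  proof -
    have "net_outflow N (\<lambda>e. ?\<delta> e * flow x e) j =
        net_outflow N (\<lambda>e. edge_conc x e * flow x e - edge_conc y e * flow y e) j"
      by (rule net_outflow_cong) (simp add: flow left_diff_distrib)
    also have "\<dots> = hydrogen_outflow N x j - hydrogen_outflow N y j"
      by (simp add: net_outflow_diff hydrogen_outflow_def)
    also have "\<dots> = - (?w j * ?d j)"
      using node_cases[OF that] x y flow_sums
      by (auto simp: hgfs_solution_def algebra_simps)
    finally show ?thesis .
  qed
  have "flow x e = 0" if "e \<in> in_arcs (net_graph N) i \<union> out_arcs (net_graph N) i" for e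
  proof (rule concentration_difference_only_at_stagnant[OF G conn few _ _ _ mass hydrogen i(1) _ that])
    show "?\<delta> a = ?d (tail (net_graph N) a)" if "a \<in> arcs (net_graph N)" "flow x a > 0" for a
      using edge_conc_upwind(1)[OF N x that(1)] edge_conc_upwind(1)[OF N y that(1)] that flow by simp
    show "?\<delta> a = ?d (head (net_graph N) a)" if "a \<in> arcs (net_graph N)" "flow x a < 0" for a
      using edge_conc_upwind(2)[OF N x that(1)] edge_conc_upwind(2)[OF N y that(1)] that flow by simp
    show "?w j \<ge> 0" for j
      using b by (auto simp: valid_boundary_data_def)
    show "?d i \<noteq> 0" using neq by simp
  qed
  then show False using i(2) by (auto simp: stagnant_def)
qed

text \<open>
  A concentration is undetermined only where the flow vanishes, and there the pressure drop of a
  pipe is zero whatever the concentration.  Hence the potentials agree at one end of an edge iff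
  they agree at the other; for compressors this uses that the ratio is nonzero.
\<close>

lemma hgfs_potential_unique:
  assumes N: "valid_network N" and conn: "connected (net_graph N)"
    and slack: "slack_nodes N \<noteq> {}" and b: "valid_boundary_data N b"
    and x: "hgfs_solution N p b x" and y: "hgfs_solution N p b y"
    and flow: "\<And>e. e \<in> arcs (net_graph N) \<Longrightarrow> flow x e = flow y e"
    and conc: "\<And>e. e \<in> arcs (net_graph N) \<Longrightarrow> flow x e \<noteq> 0 \<Longrightarrow> edge_conc x e = edge_conc y e"
    and i: "i \<in> verts (net_graph N)"
  shows "potential x i = potential y i"
proof (rule ccontr)
  assume neq: "potential x i \<noteq> potential y i"
  let ?U = "{j. potential x j = potential y j}"
  obtain s where s: "s \<in> slack_nodes N" using slack by blast
  have "s \<in> verts (net_graph N)" "s \<in> ?U"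
    using N x y s by (auto simp: valid_network_def hgfs_solution_def)
  with connected_cut_crossed[OF conn, of s ?U i] i neq
  obtain e where e: "e \<in> arcs (net_graph N)"
    and crosses: "(tail (net_graph N) e \<in> ?U) \<noteq> (head (net_graph N) e \<in> ?U)" by blast
  consider "e \<in> pipes N" | "e \<in> compressors N" using N e by (auto simp: valid_network_def)
  then show False
  proof cases
    case 1
    have "eos_V p (edge_conc x e) * (flow x e * \<bar>flow x e\<bar>) =
        eos_V p (edge_conc y e) * (flow y e * \<bar>flow y e\<bar>)"
      using flow[OF e] conc[OF e] by (cases "flow x e = 0") auto
    then have "potential x (tail (net_graph N) e) - potential x (head (net_graph N) e) =
        potential y (tail (net_graph N) e) - potential y (head (net_graph N) e)"
      using x y 1 by (simp add: hgfs_solution_def mult.assoc)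
    then show False using crosses by auto
  next
    case 2
    have "compression_ratio b e \<noteq> 0" using b 2 by (force simp: valid_boundary_data_def)
    then show False using crosses x y 2 by (auto simp: hgfs_solution_def)
  qed
qed

theorem theorem1:
  fixes N :: "('n, 'e) gas_network"
    and p :: gas_params
    and b :: "('n, 'e) boundary_data"
    and x y :: "('n, 'e) gas_state"
  assumes "valid_network N"
    and "valid_params p"
    and "connected (net_graph N)"
    and "card (pipes N) + card (compressors N) = card (verts (net_graph N)) - 1"
    and "card (slack_nodes N) = 1"
    and "valid_boundary_data N b"
    and "hgfs_solution N p b x"
    and "hgfs_solution N p b y"
  shows "((\<forall>i\<in>verts (net_graph N). \<not> stagnant N x i) \<longrightarrow> coincide N x y) \<and>
    (\<forall>e\<in>arcs (net_graph N). flow x e = flow y e) \<and>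
    (\<forall>i\<in>verts (net_graph N). potential x i = potential y i) \<and>
    (\<forall>i\<in>verts (net_graph N). \<not> stagnant N x i \<longrightarrow> node_conc x i = node_conc y i) \<and>
    (\<forall>e\<in>arcs (net_graph N).
       \<not> stagnant N x (tail (net_graph N) e) \<and> \<not> stagnant N x (head (net_graph N) e)
       \<longrightarrow> edge_conc x e = edge_conc y e)"
proof -
  let ?G = "net_graph N"
  note N = assms(1) and conn = assms(3) and b = assms(6) and x = assms(7) and y = assms(8)
  interpret fin_digraph ?G using N by (simp add: valid_network_def)
  obtain s where s: "slack_nodes N = {s}" using assms(5) by (rule card_1_singletonE)
  then have "verts ?G \<noteq> {}" using N by (auto simp: valid_network_def)
  then have "card (verts ?G) > 0" by (simp add: card_gt_0_iff)
  moreover have pc: "pipes N \<union> compressors N = arcs ?G" "pipes N \<inter> compressors N = {}"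
    using N by (auto simp: valid_network_def)
  moreover have "finite (pipes N)" "finite (compressors N)"
    using pc(1) finite_arcs by (metis finite_Un)+
  ultimately have few: "card (arcs ?G) + 1 \<le> card (verts ?G)"
    using assms(4) card_Un_disjoint[of "pipes N" "compressors N"] by simp
  have flow: "flow x e = flow y e" if "e \<in> arcs ?G" for e
    by (rule hgfs_flow_unique[OF N conn few s x y that])
  have node: "node_conc x i = node_conc y i" if "i \<in> verts ?G" "\<not> stagnant N x i" for i
    by (rule hgfs_node_conc_unique[OF N conn few b x y flow that])
  have edge: "edge_conc x e = edge_conc y e"
    if "e \<in> arcs ?G" "\<not> stagnant N x (tail ?G e)" "\<not> stagnant N x (head ?G e)" for e
  proof -
    have "node_conc x (tail ?G e) = node_conc y (tail ?G e)"
      "node_conc x (head ?G e) = node_conc y (head ?G e)"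
      using node that by auto
    moreover have "e \<in> pipes N \<or> e \<in> compressors N" using that(1) pc by blast
    ultimately show ?thesis using x y flow[OF that(1)] by (auto simp: hgfs_solution_def)
  qed
  have potential: "potential x i = potential y i" if "i \<in> verts ?G" for i
  proof (rule hgfs_potential_unique[OF N conn _ b x y flow _ that])
    show "slack_nodes N \<noteq> {}" using s by simp
    show "edge_conc x e = edge_conc y e" if "e \<in> arcs ?G" "flow x e \<noteq> 0" for e
      using that by (intro edge) (auto simp: stagnant_def in_arcs_def out_arcs_def)
  qed
  show ?thesis
    using flow node edge potential by (auto simp: coincide_def)
qed

end
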